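(* Let $t \geq 5$ be an integer and let $G$ be a connected graph on $n$ vertices satisfying $\sigma_2(G) \geq \frac{t-3}{t-2}n$. If $G$ has no Hamiltonian path, then $n \geq 2t-4$, and moreover: (1) if $n > 2t-4$, then $G$ has an induced subgraph isomorphic to $K_{1,t}$; (2) if $n = 2t-4$, then $G$ is of the form $H \vee \overline{K}_{t-1}$ where $H$ is a graph on $t-3$ vertices.
   Context: All graphs are finite and simple. A Hamiltonian path of $G$ is a path containing all vertices of $G$. For a graph $G$, $\sigma_2(G)$ denotes the minimum of $\deg(x)+\deg(y)$ over all pairs of distinct nonadjacent vertices $x,y$ of $G$. $K_{1,t}$ denotes the star with one center vertex adjacent to $t$ pairwise nonadjacent leaves. $G \vee H$ denotes the join of graphs $G$ and $H$ (disjoint union plus all edges between $V(G)$ and $V(H)$), and $\overline{K}_{t-1}$ denotes the edgeless graph on $t-1$ vertices. *)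

theory Defs
  imports Main "HOL-Library.Extended_Real"
begin

definition simple_graph :: "'a set \<Rightarrow> ('a \<Rightarrow> 'a \<Rightarrow> bool) \<Rightarrow> bool" where
  "simple_graph V E \<longleftrightarrow> finite V \<and> (\<forall>x y. E x y \<longrightarrow> E y x) \<and> (\<forall>x. \<not> E x x)
     \<and> (\<forall>x y. E x y \<longrightarrow> x \<in> V \<and> y \<in> V)"

definition degree :: "'a set \<Rightarrow> ('a \<Rightarrow> 'a \<Rightarrow> bool) \<Rightarrow> 'a \<Rightarrow> nat" where
  "degree V E x = card {y \<in> V. E x y}"

definition connected_graph :: "'a set \<Rightarrow> ('a \<Rightarrow> 'a \<Rightarrow> bool) \<Rightarrow> bool" where
  "connected_graph V E \<longleftrightarrow> V \<noteq> {} \<and>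
     (\<forall>x\<in>V. \<forall>y\<in>V. (\<lambda>u v. u \<in> V \<and> v \<in> V \<and> E u v)\<^sup>*\<^sup>* x y)"

definition hamiltonian_path :: "'a set \<Rightarrow> ('a \<Rightarrow> 'a \<Rightarrow> bool) \<Rightarrow> 'a list \<Rightarrow> bool" where
  "hamiltonian_path V E p \<longleftrightarrow> p \<noteq> [] \<and> distinct p \<and> set p = V \<and>
     (\<forall>i. Suc i < length p \<longrightarrow> E (p ! i) (p ! Suc i))"

text \<open>sigma_2: minimum of deg x + deg y over distinct nonadjacent pairs
(infinity if there is no such pair, i.e. the usual convention for complete graphs).\<close>
definition sigma2 :: "'a set \<Rightarrow> ('a \<Rightarrow> 'a \<Rightarrow> bool) \<Rightarrow> ereal" where
  "sigma2 V E = (INF p \<in> {(x, y). x \<in> V \<and> y \<in> V \<and> x \<noteq> y \<and> \<not> E x y}.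
                    ereal (real (degree V E (fst p) + degree V E (snd p))))"

definition has_induced_star :: "'a set \<Rightarrow> ('a \<Rightarrow> 'a \<Rightarrow> bool) \<Rightarrow> nat \<Rightarrow> bool" where
  "has_induced_star V E t \<longleftrightarrow> (\<exists>c L. c \<in> V \<and> L \<subseteq> V \<and> c \<notin> L \<and> card L = t \<and>
     (\<forall>l\<in>L. E c l) \<and> (\<forall>l\<in>L. \<forall>l'\<in>L. \<not> E l l'))"

definition is_join_with_empty :: "'a set \<Rightarrow> ('a \<Rightarrow> 'a \<Rightarrow> bool) \<Rightarrow> nat \<Rightarrow> nat \<Rightarrow> bool" where
  "is_join_with_empty V E k m \<longleftrightarrow> (\<exists>A B. A \<union> B = V \<and> A \<inter> B = {} \<and> card A = k \<and> card B = m \<and>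
     (\<forall>b\<in>B. \<forall>b'\<in>B. \<not> E b b') \<and> (\<forall>a\<in>A. \<forall>b\<in>B. E a b))"

end

theory Submission
  imports Defs
begin

text \<open>
  Put \<open>K = n / (t - 2)\<close>, so that nonadjacent vertices have degree sum at least \<open>n - K\<close>, where
  \<open>n \<ge> 3 K\<close>. Let \<open>p = v\<^sub>1 \<dots> v\<^sub>m\<close> be a longest path. If \<open>Q\<close> is a maximal path outside \<open>p\<close> with at least
  two vertices and last vertex \<open>y\<close>, then rotating \<open>p\<close> at the neighbours of \<open>y\<close> shows that the gaps
  between these neighbours contain positions which neither \<open>v\<^sub>1\<close> nor \<open>v\<^sub>m\<close> can use, and the degrees of
  \<open>v\<^sub>1\<close>, \<open>v\<^sub>m\<close> and \<open>y\<close> become too small. Hence all neighbours of a vertex outside \<open>p\<close> lie on \<open>p\<close>.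
  Choose \<open>p\<close> and \<open>x\<close> outside \<open>p\<close> such that \<open>d = deg x\<close> is maximum; the same count with \<open>x\<close> in place of \<open>y\<close>
  gives \<open>2 d \<ge> n - K\<close>, because a rotation that would spoil it produces another longest path, missing a
  nonneighbour of \<open>x\<close> whose degree is at most \<open>d\<close>.

  The set \<open>I\<close> of \<open>x\<close>, \<open>v\<^sub>1\<close> and the successors of the neighbours of \<open>x\<close> is independent of size \<open>d + 2\<close>
  and avoids the \<open>d\<close> neighbours of \<open>x\<close>. Thus \<open>n \<ge> 2 d + 2\<close>, which yields \<open>n \<ge> 2 t - 4\<close> and the join
  structure in the case of equality. If \<open>n > 2 t - 4\<close>, counting the edges that leave \<open>I\<close> gives a vertex with
  \<open>t\<close> neighbours in \<open>I\<close>, except when \<open>t = 5\<close> and \<open>n = 3 d\<close> is \<open>9\<close> or \<open>12\<close>; there one also compares \<open>I\<close> with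
  the analogous set of predecessors.
\<close>

section \<open>Cutting a list at given positions, and cardinalities as sums\<close>

lemma list_split_2:
  assumes "0 < j" "j < length p"
  obtains A B where "p = A @ B" "A \<noteq> []" "B \<noteq> []" "length A = j"
    "hd A = hd p" "last A = p ! (j - 1)" "hd B = p ! j" "last B = last p"
proof
  show "p = take j p @ drop j p" by simp
  show "last (take j p) = p ! (j - 1)" using assms by (subst last_conv_nth) auto
qed (use assms in \<open>auto simp: hd_drop_conv_nth\<close>)

lemma list_split_3:
  assumes "0 < i" "i < j" "j < length p"
  obtains A M B where "p = A @ M @ B" "A \<noteq> []" "M \<noteq> []" "B \<noteq> []" "length A = i" "length M = j - i"
    "hd A = hd p" "last A = p ! (i - 1)" "hd M = p ! i" "last M = p ! (j - 1)"
    "hd B = p ! j" "last B = last p"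
proof
  have "take j p = take i p @ drop i (take j p)"
    using assms by (metis append_take_drop_id min.absorb1 less_imp_le take_take)
  then show "p = take i p @ drop i (take j p) @ drop j p"
    by (metis append.assoc append_take_drop_id)
  show "last (take i p) = p ! (i - 1)" "last (drop i (take j p)) = p ! (j - 1)"
    using assms by (subst last_conv_nth; auto)+
qed (use assms in \<open>auto simp: hd_drop_conv_nth\<close>)

lemma card_filter_eq_sum: "finite A \<Longrightarrow> card {c \<in> A. P c} = (\<Sum>c\<in>A. if P c then 1 else 0)"
  using sum.inter_filter[of A "\<lambda>_. 1 :: nat" P] by simp

section \<open>Longest paths in a connected graph without a Hamiltonian path\<close>

locale nontraceable_graph =
  fixes V :: "'a set" and E :: "'a \<Rightarrow> 'a \<Rightarrow> bool"
  assumes simple: "simple_graph V E"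
    and connected: "connected_graph V E"
    and nontraceable: "\<nexists>p. hamiltonian_path V E p"
begin

lemma finite_V [simp]: "finite V" and E_sym: "E x y \<Longrightarrow> E y x" and E_irrefl [simp]: "\<not> E x x"
  and E_V2: "E x y \<Longrightarrow> y \<in> V"
  using simple unfolding simple_graph_def by blast+

lemma E_commute: "E x y \<longleftrightarrow> E y x"
  using E_sym by blast

abbreviation deg :: "'a \<Rightarrow> nat" where "deg \<equiv> degree V E"

lemma degree_eq: "deg x = card {y. E x y}"
  unfolding degree_def by (rule arg_cong[where f = card]) (auto simp: E_V2)

definition path :: "'a list \<Rightarrow> bool" where
  "path p \<longleftrightarrow> p \<noteq> [] \<and> distinct p \<and> set p \<subseteq> V \<and> successively E p"

definition longest :: "'a list \<Rightarrow> bool" where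
  "longest p \<longleftrightarrow> path p \<and> (\<forall>q. path q \<longrightarrow> length q \<le> length p)"

lemma successively_E_rev [simp]: "successively E (rev p) \<longleftrightarrow> successively E p"
proof -
  have "(\<lambda>x y. E y x) = E" by (intro ext) (rule E_commute)
  then show ?thesis
    by (subst successively_rev) (rule arg_cong[where f = "\<lambda>R. successively R p"])
qed

lemma path_rev [simp]: "path (rev p) \<longleftrightarrow> path p"
  by (simp add: path_def del: successively_rev)

lemma path_append [simp]:
  assumes "p \<noteq> []" "q \<noteq> []"
  shows "path (p @ q) \<longleftrightarrow> path p \<and> path q \<and> set p \<inter> set q = {} \<and> E (last p) (hd q)"
  using assms by (auto simp: path_def successively_append_iff)

lemma path_singleton [simp]: "path [x] \<longleftrightarrow> x \<in> V"
  by (simp add: path_def)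

lemma path_Cons [simp]: "p \<noteq> [] \<Longrightarrow> path (x # p) \<longleftrightarrow> x \<in> V \<and> path p \<and> x \<notin> set p \<and> E x (hd p)"
  using path_append[of "[x]" p] by simp

lemma path_length: "path p \<Longrightarrow> length p \<le> card V"
  unfolding path_def by (metis card_mono distinct_card finite_V)

lemma longest_rev [simp]: "longest (rev p) \<longleftrightarrow> longest p"
  by (simp add: longest_def)

lemma longest_path: "longest p \<Longrightarrow> path p"
  by (simp add: longest_def)

lemma longest_length: "longest p \<Longrightarrow> path q \<Longrightarrow> length q \<le> length p"
  by (simp add: longest_def)

lemma longest_nonempty: "longest p \<Longrightarrow> p \<noteq> []"
  by (simp add: longest_def path_def)

lemma longest_ex_off:
  assumes "longest p"
  obtains z where "z \<in> V" "z \<notin> set p"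
proof -
  have "set p \<noteq> V"
    using nontraceable assms
    by (auto simp: longest_def path_def hamiltonian_path_def successively_conv_nth)
  then show thesis using assms that by (auto simp: longest_def path_def)
qed

lemma longest_length_less: "longest p \<Longrightarrow> length p < card V"
  using longest_ex_off[of p]
  by (metis distinct_card finite_V longest_path path_def psubsetI psubset_card_mono)

text \<open>A walk from \<open>hd p\<close> to a missed vertex has to leave \<open>set p\<close>
  along some edge.\<close>

lemma longest_attached:
  assumes "longest p"
  obtains z v where "z \<in> V" "z \<notin> set p" "v \<in> set p" "E z v"
proof -
  obtain y where y: "y \<in> V" "y \<notin> set p" using longest_ex_off assms by blast
  have x: "hd p \<in> set p" "hd p \<in> V" using assms by (auto simp: longest_def path_def)
  have "(\<lambda>u v. u \<in> V \<and> v \<in> V \<and> E u v)\<^sup>*\<^sup>* (hd p) y"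
    using connected x y by (auto simp: connected_graph_def)
  then have "y \<in> set p \<or> (\<exists>z v. z \<in> V \<and> z \<notin> set p \<and> v \<in> set p \<and> E z v)"
    by (induction rule: rtranclp_induct) (use x in \<open>auto intro: E_sym\<close>)
  with y that show thesis by blast
qed

text \<open>Otherwise the vertices of \<open>p\<close> lie on a cycle. Opening it at a vertex
  \<open>v\<close> that has a neighbour \<open>z\<close> off \<open>p\<close>, and prepending
  \<open>z\<close>, gives a longer path.\<close>

lemma longest_no_cycle:
  assumes p: "longest p" and c: "path c" "set c = set p"
  shows "\<not> E (last c) (hd c)"
proof
  assume e: "E (last c) (hd c)"
  obtain z v where z: "z \<in> V" "z \<notin> set p" "v \<in> set p" "E z v" using p by (rule longest_attached)
  then obtain A B where AB: "c = A @ v # B" using c by (metis split_list)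
  have "path (z # v # B @ A)"
  proof (cases "A = []")
    case True then show ?thesis using c z AB by auto
  next
    case False
    then have 1: "path A" "path (v # B)" "set A \<inter> set (v # B) = {}" using c AB by auto
    then have "path ((v # B) @ A)" using e AB False by (subst path_append) auto
    then show ?thesis using z c AB by auto
  qed
  from longest_length[OF p this] have "Suc (length c) \<le> length p" using AB by simp
  moreover have "length c = length p"
    using c p by (metis distinct_card longest_path path_def)
  ultimately show False by simp
qed

section \<open>Path surgery: exchanges, rotations and insertions\<close>

lemma longest_prefix_exchange:
  assumes "longest p" "path Q" "set Q \<inter> set p = {}" "p = A @ B" "B \<noteq> []" "E (last Q) (hd B)"
  shows "length Q \<le> length A"
proof -
  have "path B" using assms longest_path[OF assms(1)] by (cases "A = []") auto
  then have "path (Q @ B)" using assms by (subst path_append) (auto simp: path_def)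
  from longest_length[OF assms(1) this] show ?thesis using assms by simp
qed

text \<open>Run through \<open>Q\<close>, jump to \<open>last A\<close>, go back along
  \<open>A\<close> to \<open>hd p\<close>, and jump to \<open>hd B\<close>. Only \<open>M\<close> is
  lost.\<close>

lemma longest_rotate_exchange:
  assumes p: "longest p" and Q: "path Q" "set Q \<inter> set p = {}"
    and "p = A @ M @ B" "A \<noteq> []" "B \<noteq> []" and e: "E (last Q) (last A)" "E (hd p) (hd B)"
  shows "path (Q @ rev A @ B)" "length Q \<le> length M"
proof -
  have "path A" "path B" "set A \<inter> set B = {}"
    using assms longest_path[OF p] by (cases "M = []"; auto)+
  then show "path (Q @ rev A @ B)"
    using assms by (simp add: path_def[of Q] hd_rev last_rev) auto
  from longest_length[OF p this] show "length Q \<le> length M" using assms by simp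
qed

text \<open>From \<open>y\<close> a path runs back through \<open>X\<close> to \<open>hd p\<close>,
  jumps to the end of \<open>Y\<close>, runs back through \<open>Y\<close>, jumps to
  \<open>last p\<close> and runs back through \<open>Z\<close>. It keeps all of \<open>p\<close> and
  gains \<open>y\<close>.\<close>

lemma longest_no_twist:
  assumes p: "longest p" and y: "y \<in> V" "y \<notin> set p"
    and "p = X @ Y @ Z" "X \<noteq> []" "Y \<noteq> []" "Z \<noteq> []"
    and "E y (last X)" "E (hd p) (last Y)" "E (last p) (hd Y)"
  shows False
proof -
  have "path ([y] @ rev X @ rev Y @ rev Z)"
    using assms longest_path[OF p] by (auto simp: hd_rev last_rev E_commute)
  from longest_length[OF p this] show ?thesis using assms by simp
qed

lemma longest_no_insert:
  assumes p: "longest p" and y: "y \<in> V" "y \<notin> set p"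
    and "p = X @ Z" "X \<noteq> []" "Z \<noteq> []" "E y (last X)" "E y (hd Z)"
  shows False
proof -
  have "path (X @ [y] @ Z)"
    using assms longest_path[OF p] by (auto simp: E_commute)
  from longest_length[OF p this] show ?thesis using assms by simp
qed

text \<open>The longer path is \<open>X @ [x] @ rev Y @ W @ Z\<close>. Here \<open>hd Y\<close> and
  \<open>hd Z\<close> are successors of neighbours of \<open>x\<close>, linked directly or through
  an outside path \<open>W\<close>. An empty \<open>X\<close> is allowed, so that
  \<open>hd p\<close> counts as such a successor.\<close>

lemma longest_no_reinsert:
  assumes p: "longest p" and x: "x \<in> V" "x \<notin> set p"
    and "p = X @ Y @ Z" "Y \<noteq> []" "Z \<noteq> []"
    and "X \<noteq> [] \<Longrightarrow> E x (last X)" "E x (last Y)"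
    and W: "W = [] \<and> E (hd Y) (hd Z) \<or> path W \<and> set W \<inter> insert x (set p) = {} \<and> E (hd Y) (hd W) \<and> E (last W) (hd Z)"
  shows False
proof -
  have Z: "path Z" "path Y" "set Y \<inter> set Z = {}" "X \<noteq> [] \<Longrightarrow> path X" "set X \<inter> (set Y \<union> set Z) = {}"
    using assms longest_path[OF p] by (cases "X = []"; auto)+
  have "path (W @ Z)" "set (W @ Z) \<inter> set Y = {}" "E (hd Y) (hd (W @ Z))"
    using Z W assms by (auto simp: path_def[of W])
  then have 1: "path (rev Y @ (W @ Z))"
    using Z assms by (subst path_append) (auto simp: last_rev)
  have "path ([x] @ rev Y @ W @ Z)"
    using 1 W assms by (subst path_append) (auto simp: hd_rev)
  then have "path (X @ [x] @ rev Y @ W @ Z)"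
    using Z W assms by (cases "X = []") (auto simp: E_commute)
  from longest_length[OF p this] show ?thesis using assms by simp
qed

section \<open>Positions of neighbours on a longest path, and the degrees of its ends\<close>

definition nbr_idx :: "'a \<Rightarrow> 'a list \<Rightarrow> nat set" where
  "nbr_idx y p = {i. i < length p \<and> E y (p ! i)}"

lemma finite_nbr_idx [simp]: "finite (nbr_idx y p)"
  by (simp add: nbr_idx_def)

lemma card_nbr_idx: "path p \<Longrightarrow> card (nbr_idx y p) = card {z \<in> set p. E y z}"
  by (rule bij_betw_same_card[of "nth p"])
    (auto simp: bij_betw_def nbr_idx_def inj_on_def path_def nth_eq_iff_index_eq in_set_conv_nth)

lemma degree_nbr_idx:
  assumes "path p" "\<And>z. E y z \<Longrightarrow> z \<in> set p"
  shows "deg y = card (nbr_idx y p)"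
proof -
  have "{z. E y z} = {z \<in> set p. E y z}" using assms by auto
  then show ?thesis using assms by (simp add: degree_eq card_nbr_idx)
qed

lemma nbr_idx_rev: "nbr_idx y (rev p) = (\<lambda>i. length p - Suc i) ` nbr_idx y p"
proof -
  have "i \<in> (\<lambda>i. length p - Suc i) ` nbr_idx y p" if "i < length p" "E y (p ! (length p - Suc i))" for i
    by (rule image_eqI[of _ _ "length p - Suc i"]) (use that in \<open>auto simp: nbr_idx_def\<close>)
  then show ?thesis by (auto simp: nbr_idx_def rev_nth)
qed

lemma longest_hd_nbr:
  assumes "longest p" "E (hd p) z"
  shows "z \<in> set p"
proof (rule ccontr)
  assume "z \<notin> set p"
  then have "length [z] \<le> length ([] :: 'a list)"
    using assms by (intro longest_prefix_exchange[of p "[z]" "[]" p])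
      (auto simp: E_V2 longest_nonempty E_sym)
  then show False by simp
qed

lemma longest_last_nbr:
  assumes "longest p" "E (last p) z"
  shows "z \<in> set p"
  using longest_hd_nbr[of "rev p" z] assms by (simp add: hd_rev)

text \<open>A crossing pair would close \<open>A @ rev B\<close> into a cycle through all vertices
  of \<open>p\<close>.\<close>

lemma longest_no_crossing:
  assumes p: "longest p" and j: "0 < j" "j < length p"
    and e: "E (hd p) (p ! j)" "E (last p) (p ! (j - 1))"
  shows False
proof -
  obtain A B where AB: "p = A @ B" "A \<noteq> []" "B \<noteq> []" "length A = j"
    "hd A = hd p" "last A = p ! (j - 1)" "hd B = p ! j" "last B = last p"
    using j by (rule list_split_2)
  have "path A" "path B" "set A \<inter> set B = {}" using longest_path[OF p] AB by auto
  then have "path (A @ rev B)"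
    using AB e by (subst path_append) (auto simp: hd_rev E_commute)
  moreover have "set (A @ rev B) = set p" using AB(1) by simp
  ultimately have "\<not> E (hd B) (hd A)"
    using longest_no_cycle[OF p, of "A @ rev B"] AB(2,3) by (simp add: last_rev)
  then show False using AB(5,7) e E_sym by simp
qed

text \<open>The neighbour positions of \<open>hd p\<close> and those of \<open>last p\<close>, the
  latter shifted by one, are disjoint by the crossing argument. Both sets lie in
  \<open>{1..<length p}\<close>, and \<open>M\<close> collects further positions missed by
  both.\<close>

lemma longest_ends_degree:
  assumes p: "longest p" and M: "M \<subseteq> {1..<length p}"
    and free: "\<And>j. j \<in> M \<Longrightarrow> \<not> E (hd p) (p ! j) \<and> \<not> E (last p) (p ! (j - 1))"
  shows "deg (hd p) + deg (last p) + card M + 1 \<le> length p"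
proof -
  let ?A = "nbr_idx (hd p) p" and ?B = "Suc ` nbr_idx (last p) p"
  have ne: "p \<noteq> []" using p by (rule longest_nonempty)
  have A: "?A \<subseteq> {1..<length p}"
    using ne by (auto simp: nbr_idx_def hd_conv_nth Suc_le_eq intro!: gr0I)
  have B: "?B \<subseteq> {1..<length p}"
  proof
    fix j assume "j \<in> ?B"
    then obtain i where i: "j = Suc i" "i < length p" "E (last p) (p ! i)" by (auto simp: nbr_idx_def)
    then have "i \<noteq> length p - 1" using ne by (auto simp: last_conv_nth)
    then show "j \<in> {1..<length p}" using i by auto
  qed
  have AB: "?A \<inter> ?B = {}"
    using longest_no_crossing[OF p, of "Suc i" for i] by (auto simp: nbr_idx_def)
  have M': "(?A \<union> ?B) \<inter> M = {}"
    using free free[of "Suc i" for i] by (fastforce simp: nbr_idx_def)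
  have "finite M" using M finite_subset by blast
  then have "card (?A \<union> ?B \<union> M) = card ?A + card ?B + card M"
    using AB M' by (simp add: card_Un_disjoint)
  moreover have "card (?A \<union> ?B \<union> M) \<le> card {1..<length p}"
    using A B M by (intro card_mono) auto
  moreover have "card ?A = deg (hd p)"
    using degree_nbr_idx[OF longest_path[OF p]] longest_hd_nbr[OF p] by auto
  moreover have "card ?B = deg (last p)"
    using degree_nbr_idx[OF longest_path[OF p]] longest_last_nbr[OF p] by (auto simp: card_image)
  moreover have "length p > 0" using ne by simp
  ultimately show ?thesis by (simp only: card_atLeastLessThan)
qed

lemma nbr_idx_not_consecutive:
  assumes p: "longest p" and y: "y \<in> V" "y \<notin> set p"
    and i: "i \<in> nbr_idx y p" "Suc i \<in> nbr_idx y p"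
  shows False
proof -
  have "0 < Suc i" "Suc i < length p" using i by (auto simp: nbr_idx_def)
  then obtain A B where AB: "p = A @ B" "A \<noteq> []" "B \<noteq> []"
    "last A = p ! (Suc i - 1)" "hd B = p ! Suc i"
    by (rule list_split_2)
  show False
    by (rule longest_no_insert[OF p y AB(1-3)]) (use AB(4,5) i in \<open>auto simp: nbr_idx_def\<close>)
qed

lemma nbr_idx_gap:
  assumes "longest p" "y \<in> V" "y \<notin> set p" "i \<in> nbr_idx y p" "j \<in> nbr_idx y p" "i < j"
  shows "i + 2 \<le> j"
proof -
  have "j \<noteq> Suc i" using nbr_idx_not_consecutive[of p y i] assms by blast
  then show ?thesis using assms(6) by simp
qed

lemma longest_no_twist_idx:
  assumes p: "longest p" and y: "y \<in> V" "y \<notin> set p"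
    and "i \<in> nbr_idx y p" "E (last p) (p ! Suc i)" "i < j" "Suc j < length p" "E (hd p) (p ! j)"
  shows False
proof -
  have "0 < Suc i" "Suc i < Suc j" "Suc j < length p" using assms by auto
  then obtain A M B where AB: "p = A @ M @ B" "A \<noteq> []" "M \<noteq> []" "B \<noteq> []"
    "last A = p ! (Suc i - 1)" "hd M = p ! Suc i" "last M = p ! (Suc j - 1)"
    by (rule list_split_3)
  show False
    by (rule longest_no_twist[OF p y AB(1-4)]) (use AB(5-) assms in \<open>auto simp: nbr_idx_def\<close>)
qed

text \<open>For each neighbour index \<open>i\<close> of \<open>y\<close> except the pivot \<open>s\<close>, a position is found that contributes
to neither end: \<open>i + 2\<close> if \<open>i < s\<close>, and \<open>i - 1\<close> if \<open>i > s\<close>.\<close>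

lemma longest_ends_degree_gaps:
  assumes p: "longest p" and y: "y \<in> V" "y \<notin> set p" and ne: "nbr_idx y p \<noteq> {}"
    and hd: "\<And>i. i \<in> nbr_idx y p \<Longrightarrow> i + 2 < length p \<Longrightarrow> \<not> E (hd p) (p ! (i + 2))"
    and last_rev: "\<And>i. i \<in> nbr_idx y (rev p) \<Longrightarrow> i + 2 < length p \<Longrightarrow> \<not> E (last p) (rev p ! (i + 2))"
  shows "deg (hd p) + deg (last p) + card (nbr_idx y p) \<le> length p"
proof -
  have last: "\<not> E (last p) (p ! (i - 2))" if "i \<in> nbr_idx y p" "2 \<le> i" for i
  proof -
    have "i < length p" using that by (simp add: nbr_idx_def)
    then have "rev p ! (length p - Suc i + 2) = p ! (i - 2)"
      using that by (simp add: rev_nth) (rule arg_cong[where f = "nth p"], linarith)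
    then show ?thesis
      using last_rev[of "length p - Suc i"] that \<open>i < length p\<close> by (auto simp: nbr_idx_rev)
  qed
  define N where "N = nbr_idx y p"
  have fin: "finite N" "N \<noteq> {}" using ne by (auto simp: N_def)
  have less: "i < length p" if "i \<in> N" for i using that by (auto simp: N_def nbr_idx_def)
  have nc: "i + 2 \<le> j" if "i \<in> N" "j \<in> N" "i < j" for i j
    using nbr_idx_gap[OF p y, of i j] that unfolding N_def by blast
  define B where "B = {i \<in> N. E (last p) (p ! Suc i)}"
  \<comment> \<open>The pivot is the least neighbour position whose successor is adjacent to
    \<open>last p\<close>. If there is none, it is the greatest neighbour position, with nothing to
    its right.\<close>
  obtain s where s: "s \<in> N" "\<And>i. i \<in> N \<Longrightarrow> i < s \<Longrightarrow> i \<notin> B" "\<And>i. i \<in> N \<Longrightarrow> s < i \<Longrightarrow> s \<in> B"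
  proof (cases "B = {}")
    case True
    then show ?thesis using that[of "Max N"] fin by (auto simp: not_less[symmetric])
  next
    case False
    have "finite B" using fin by (simp add: B_def)
    with False have "Min B \<in> B" "\<And>i. i < Min B \<Longrightarrow> i \<notin> B" by (auto simp: not_less[symmetric])
    moreover from this(1) have "Min B \<in> N" by (simp add: B_def)
    ultimately show ?thesis using that[of "Min B"] by blast
  qed
  let ?L = "(\<lambda>i. i + 2) ` {i \<in> N. i < s}" and ?R = "(\<lambda>i. i - 1) ` {i \<in> N. s < i}"
  have disj: "?L \<inter> ?R = {}"
  proof -
    have "i + 2 \<noteq> j - 1" if "i \<in> N" "i < s" "j \<in> N" "s < j" for i j
      using nc[of i s] nc[of s j] that s(1) by linarith
    then show ?thesis by auto
  qed
  have "card ?L = card {i \<in> N. i < s}" by (rule card_image) (auto simp: inj_on_def)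
  moreover have "card ?R = card {i \<in> N. s < i}" by (rule card_image) (auto simp: inj_on_def)
  ultimately have "card (?L \<union> ?R) = card {i \<in> N. i < s} + card {i \<in> N. s < i}"
    using disj fin by (subst card_Un_disjoint) auto
  also have "\<dots> = card ({i \<in> N. i < s} \<union> {i \<in> N. s < i})"
    using fin by (subst card_Un_disjoint) auto
  also have "{i \<in> N. i < s} \<union> {i \<in> N. s < i} = N - {s}" by auto
  finally have card: "card (?L \<union> ?R) = card N - 1" using s fin by simp
  have "deg (hd p) + deg (last p) + card (?L \<union> ?R) + 1 \<le> length p"
  proof (rule longest_ends_degree[OF p])
    show "?L \<union> ?R \<subseteq> {1..<length p}"
    proof -
      have "i + 2 \<in> {1..<length p}" if "i \<in> N" "i < s" for i
        using nc[of i s] that s(1) less[of s] by auto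
      moreover have "i - 1 \<in> {1..<length p}" if "i \<in> N" "s < i" for i
        using nc[of s i] that s(1) less[of i] by auto
      ultimately show ?thesis by blast
    qed
    fix j assume "j \<in> ?L \<union> ?R"
    then consider i where "i \<in> N" "i < s" "j = i + 2" | i where "i \<in> N" "s < i" "j = i - 1" by auto
    then show "\<not> E (hd p) (p ! j) \<and> \<not> E (last p) (p ! (j - 1))"
    proof cases
      case 1
      then show ?thesis using s(2)[of i] hd[of i] nc[of i s] less[of s] s(1) by (auto simp: B_def N_def)
    next
      case 2
      \<comment> \<open>Right of the pivot, an edge from \<open>hd p\<close> to
        \<open>p ! (i - 1)\<close> would complete a twist at \<open>s\<close>; that
        \<open>last p\<close> avoids \<open>p ! (i - 2)\<close> is the hypothesis on
        \<open>rev p\<close>.\<close>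
      then have i: "s + 2 \<le> i" "i < length p" using nc s(1) less by auto
      moreover from i 2 have "s < j" "Suc j < length p" by auto
      moreover have "s \<in> nbr_idx y p" "E (last p) (p ! Suc s)"
        using s 2 by (auto simp: B_def N_def)
      ultimately have "\<not> E (hd p) (p ! j)"
        using longest_no_twist_idx[OF p y, of s j] by blast
      then show ?thesis using last[of i] i 2 by (auto simp: N_def numeral_2_eq_2)
    qed
  qed
  moreover have "card N > 0" using fin by (simp add: card_gt_0_iff)
  ultimately show ?thesis using card by (simp add: N_def)
qed

lemma longest_rotate_idx:
  assumes p: "longest p" and Q: "path Q" "set Q \<inter> set p = {}"
    and i: "i \<in> nbr_idx (last Q) p" "i < j" "j < length p" and e: "E (hd p) (p ! j)"
  shows "length Q \<le> j - Suc i"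
proof (cases "j = Suc i")
  case True
  have "0 < Suc i" "Suc i < length p" using i by auto
  then obtain A B where AB: "p = A @ B" "A \<noteq> []" "B \<noteq> []"
    "last A = p ! (Suc i - 1)" "hd B = p ! Suc i"
    by (rule list_split_2)
  then show ?thesis
    using longest_rotate_exchange(2)[OF p Q, of A "[]" B] True i e by (auto simp: nbr_idx_def)
next
  case False
  have "0 < Suc i" "Suc i < j" "j < length p" using i False by auto
  then obtain A M B where AB: "p = A @ M @ B" "A \<noteq> []" "B \<noteq> []" "length M = j - Suc i"
    "last A = p ! (Suc i - 1)" "hd B = p ! j"
    by (rule list_split_3)
  then show ?thesis
    using longest_rotate_exchange(2)[OF p Q AB(1-3)] i e by (auto simp: nbr_idx_def)
qed

text \<open>Rotating with \<open>[x]\<close> drops just \<open>p ! Suc i\<close>, so the new path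
  has the same length and is again longest.\<close>

lemma longest_swap_idx:
  assumes p: "longest p" and x: "x \<in> V" "x \<notin> set p"
    and i: "i \<in> nbr_idx x p" "i + 2 < length p" and e: "E (hd p) (p ! (i + 2))"
  obtains q where "longest q" "set q = insert x (set p - {p ! Suc i})"
proof -
  have "0 < Suc i" "Suc i < i + 2" "i + 2 < length p" using i by auto
  then obtain A M B where AB: "p = A @ M @ B" "A \<noteq> []" "B \<noteq> []" "length M = i + 2 - Suc i"
    "last A = p ! (Suc i - 1)" "hd M = p ! Suc i" "hd B = p ! (i + 2)"
    by (rule list_split_3)
  define w where "w = p ! Suc i"
  have M: "M = [w]" using AB(4,6) by (cases M) (auto simp: w_def)
  let ?q = "[x] @ rev A @ B"
  have q: "path ?q"
    using longest_rotate_exchange(1)[OF p _ _ AB(1-3), of "[x]"] AB(5,7) x i e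
    by (auto simp: nbr_idx_def)
  have p_eq: "p = A @ w # B" using AB(1) M by simp
  then have "length ?q = length p" by simp
  then have "longest ?q" using p q unfolding longest_def by metis
  moreover have "distinct p" using longest_path[OF p] by (simp add: path_def)
  then have "set ?q = insert x (set p - {w})" using p_eq by auto
  ultimately show thesis using that by (simp only: w_def)
qed

lemma longest_exchange_idx:
  assumes p: "longest p" and Q: "path Q" "set Q \<inter> set p = {}" and i: "i \<in> nbr_idx (last Q) p"
  shows "i + length Q < length p"
proof -
  have *: "length Q \<le> i" if p: "longest p" and Q: "set Q \<inter> set p = {}" and i: "i \<in> nbr_idx (last Q) p" for p i
  proof -
    have "length Q \<le> length (take i p)"
      using i by (intro longest_prefix_exchange[OF p \<open>path Q\<close> Q, of _ "drop i p"])
        (auto simp: nbr_idx_def hd_drop_conv_nth)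
    then show ?thesis by simp
  qed
  have "length Q \<le> length p - Suc i"
    using p Q i by (intro *[of "rev p"]) (auto simp: nbr_idx_rev)
  moreover have "i < length p" using i by (simp add: nbr_idx_def)
  ultimately show "i + length Q < length p" by simp
qed

text \<open>After each neighbour position of \<open>last Q\<close>, rotation forbids
  \<open>hd p\<close> the next \<open>length Q\<close> positions. Two of these are counted after
  every neighbour position but the greatest; the pairs are disjoint because the gaps are at least 2.
  After the greatest one the whole block of \<open>length Q\<close> positions still fits into
  \<open>p\<close>.\<close>

lemma longest_hd_degree_off_path:
  assumes p: "longest p" and Q: "path Q" "set Q \<inter> set p = {}" "2 \<le> length Q"
    and ne: "nbr_idx (last Q) p \<noteq> {}"
  shows "deg (hd p) + 2 * card (nbr_idx (last Q) p) + length Q \<le> length p + 1"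
proof -
  define N where "N = nbr_idx (last Q) p"
  define s where "s = Max N"
  have Qne: "Q \<noteq> []" using Q by auto
  have y: "last Q \<in> V" "last Q \<notin> set p"
    using Q Qne by (auto simp: path_def dest: last_in_set)
  have fin: "finite N" "N \<noteq> {}" using ne by (auto simp: N_def)
  then have s: "s \<in> N" "\<And>i. i \<in> N \<Longrightarrow> i \<le> s" by (auto simp: s_def)
  have less: "i < length p" if "i \<in> N" for i using that by (auto simp: N_def nbr_idx_def)
  have nc: "i + 2 \<le> j" if "i \<in> N" "j \<in> N" "i < j" for i j
    using nbr_idx_gap[OF p y, of i j] that unfolding N_def by blast
  have sQ: "s + length Q < length p"
    using longest_exchange_idx[OF p Q(1,2)] s(1) by (simp add: N_def)
  let ?H = "nbr_idx (hd p) p"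
  let ?A = "(\<lambda>i. i + 1) ` (N - {s})" and ?B = "(\<lambda>i. i + 2) ` (N - {s})" and ?C = "{s<..s + length Q}"
  have lt: "i + 2 \<le> s" if "i \<in> N - {s}" for i using that s nc by (metis DiffD1 DiffD2 insertCI le_neq_implies_less)
  have AB: "?A \<inter> ?B = {}"
  proof -
    have "i + 1 \<noteq> j + 2" if "i \<in> N - {s}" "j \<in> N - {s}" for i j
      using nc[of j i] that by auto
    then show ?thesis by auto
  qed
  have ABC: "(?A \<union> ?B) \<inter> ?C = {}" using lt by fastforce
  have "\<not> E (hd p) (p ! j)" if "i \<in> N" "i < j" "j < length p" "j \<le> i + length Q" for i j
    using longest_rotate_idx[OF p Q(1,2), of i j] that by (auto simp: N_def)
  note av = this
  have H: "?H \<inter> (?A \<union> ?B \<union> ?C) = {}"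
  proof -
    have "i + 1 \<notin> ?H" "i + 2 \<notin> ?H" if "i \<in> N - {s}" for i
      using av[of i "i + 1"] av[of i "i + 2"] lt[OF that] that less[OF s(1)] Q(3) by (auto simp: nbr_idx_def)
    moreover have "j \<notin> ?H" if "j \<in> ?C" for j
      using av[of s j] that s(1) sQ by (auto simp: nbr_idx_def)
    ultimately show ?thesis by blast
  qed
  have sub: "?H \<union> (?A \<union> ?B \<union> ?C) \<subseteq> {1..<length p}"
  proof -
    have "?H \<subseteq> {1..<length p}"
      using longest_nonempty[OF p] by (auto simp: nbr_idx_def hd_conv_nth Suc_le_eq intro!: gr0I)
    moreover have "?A \<union> ?B \<union> ?C \<subseteq> {1..<length p}" using lt sQ by fastforce
    ultimately show ?thesis by blast
  qed
  have "card (?H \<union> (?A \<union> ?B \<union> ?C)) = card ?H + card (?A \<union> ?B \<union> ?C)"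
    using H fin by (intro card_Un_disjoint) auto
  also have "card (?A \<union> ?B \<union> ?C) = card (?A \<union> ?B) + card ?C"
    using ABC fin by (intro card_Un_disjoint) auto
  also have "card (?A \<union> ?B) = card ?A + card ?B"
    using AB fin by (intro card_Un_disjoint) auto
  also have "card ?A = card N - 1" using s fin by (simp add: card_image)
  also have "card ?B = card N - 1" using s fin by (subst card_image) (auto simp: inj_on_def)
  finally have "card ?H + (card N - 1 + (card N - 1) + length Q) \<le> length p - 1"
    using card_mono[OF _ sub] by simp
  moreover have "card ?H = deg (hd p)"
    using degree_nbr_idx[OF longest_path[OF p]] longest_hd_nbr[OF p] by auto
  moreover have "card N > 0" using fin by (simp add: card_gt_0_iff)
  ultimately show ?thesis using sQ unfolding N_def by linarith
qed

lemma longest_hd_last: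
  assumes "longest p" "2 \<le> length p"
  shows "hd p \<noteq> last p" "\<not> E (hd p) (last p)" "hd p \<in> V" "last p \<in> V"
proof -
  have p: "path p" using assms longest_path by blast
  show "\<not> E (hd p) (last p)" using longest_no_cycle[OF assms(1) p] E_sym by blast
  show "hd p \<in> V" "last p \<in> V" using p by (auto simp: path_def)
  show "hd p \<noteq> last p"
    using p assms(2) by (auto simp: path_def hd_conv_nth last_conv_nth nth_eq_iff_index_eq)
qed

lemma longest_exists: "\<exists>p. longest p"
proof -
  obtain v where "v \<in> V" using connected by (auto simp: connected_graph_def)
  then have "path [v]" by simp
  moreover have "\<forall>q. path q \<longrightarrow> length q < Suc (card V)" using path_length by (auto simp: less_Suc_eq_le)
  ultimately show ?thesis unfolding longest_def by (rule ex_has_greatest_nat)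
qed

lemma longest_length_ge_2:
  assumes "longest p"
  shows "2 \<le> length p"
proof -
  obtain z v where "z \<in> V" "z \<notin> set p" "v \<in> set p" "E z v" using assms by (rule longest_attached)
  then have "path [z, v]" by (auto simp: E_V2)
  from longest_length[OF assms this] show ?thesis by simp
qed

section \<open>Independent sets formed by successors of neighbours\<close>

text \<open>Position 0 is added because the first vertex behaves like the successor of a neighbour.
  For \<open>rev p\<close> the set consists of the last vertex of \<open>p\<close> and the
  predecessors of neighbours of \<open>x\<close>.\<close>

definition succ_set :: "'a list \<Rightarrow> 'a \<Rightarrow> 'a set" where
  "succ_set p x = nth p ` insert 0 (Suc ` nbr_idx x p)"

lemma nbr_idx_Suc_less:
  assumes "longest p" "x \<in> V" "x \<notin> set p" "i \<in> nbr_idx x p"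
  shows "Suc i < length p"
  using longest_exchange_idx[of p "[x]" i] assms by simp

lemma card_succ_set:
  assumes p: "longest p" and x: "x \<in> V" "x \<notin> set p"
  shows "card (succ_set p x) = card (nbr_idx x p) + 1"
proof -
  have "inj_on (nth p) (insert 0 (Suc ` nbr_idx x p))"
    using nbr_idx_Suc_less[OF p x] longest_path[OF p]
    by (auto simp: inj_on_def path_def nth_eq_iff_index_eq)
  then show ?thesis by (simp add: succ_set_def card_image)
qed

lemma succ_set_subset:
  assumes p: "longest p" and x: "x \<in> V" "x \<notin> set p"
  shows "succ_set p x \<subseteq> set p"
  using nbr_idx_Suc_less[OF p x] longest_nonempty[OF p] by (auto simp: succ_set_def)

text \<open>Cutting \<open>p\<close> before \<open>j\<close> and \<open>k\<close> produces the
  situation of \<open>longest_no_reinsert\<close>, with an empty \<open>X\<close> if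
  \<open>j = 0\<close>.\<close>

lemma succ_set_not_linked:
  assumes p: "longest p" and x: "x \<in> V" "x \<notin> set p"
    and j: "j \<in> insert 0 (Suc ` nbr_idx x p)" and k: "k \<in> Suc ` nbr_idx x p" and jk: "j < k"
    and W: "W = [] \<and> E (p ! j) (p ! k) \<or>
      path W \<and> set W \<inter> insert x (set p) = {} \<and> E (p ! j) (hd W) \<and> E (last W) (p ! k)"
  shows False
proof -
  have kl: "k < length p" using k nbr_idx_Suc_less[OF p x] by auto
  have xk: "E x (p ! (k - 1))" using k by (auto simp: nbr_idx_def)
  show False
  proof (cases "j = 0")
    case True
    have "0 < k" using jk by simp
    then obtain Y Z where YZ: "p = Y @ Z" "Y \<noteq> []" "Z \<noteq> []" "hd Y = hd p" "last Y = p ! (k - 1)" "hd Z = p ! k"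
      using kl by (rule list_split_2)
    then have "p = [] @ Y @ Z" by simp
    moreover have "hd Y = p ! j" using YZ True longest_nonempty[OF p] by (simp add: hd_conv_nth)
    ultimately show False
      using longest_no_reinsert[OF p x, of "[]" Y Z W] YZ(2,3,5,6) xk W by simp
  next
    case False
    then have xj: "E x (p ! (j - 1))" using j by (auto simp: nbr_idx_def)
    have "0 < j" using False by simp
    then obtain X Y Z where YZ: "p = X @ Y @ Z" "Y \<noteq> []" "Z \<noteq> []"
      "last X = p ! (j - 1)" "hd Y = p ! j" "last Y = p ! (k - 1)" "hd Z = p ! k"
      using jk kl by (rule list_split_3)
    show False
      by (rule longest_no_reinsert[OF p x YZ(1-3), of W])
        (use YZ(4-7) xk xj W in simp_all)
  qed
qed

text \<open>A link with at most one inner vertex reads the same in both directions, so the order of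
  \<open>u\<close> and \<open>v\<close> along \<open>p\<close> is irrelevant.\<close>

lemma succ_set_unlinked:
  assumes p: "longest p" and x: "x \<in> V" "x \<notin> set p"
    and u: "u \<in> succ_set p x" "v \<in> succ_set p x" "u \<noteq> v"
    and W: "W = [] \<and> E u v \<or> W = [q] \<and> q \<in> V \<and> q \<notin> insert x (set p) \<and> E q u \<and> E q v"
  shows False
proof -
  obtain j k where jk: "j \<in> insert 0 (Suc ` nbr_idx x p)" "k \<in> insert 0 (Suc ` nbr_idx x p)"
    "u = p ! j" "v = p ! k"
    using u by (auto simp: succ_set_def)
  have "j \<noteq> k" using jk u by auto
  then consider "j < k" | "k < j" by linarith
  then show False
  proof cases
    case 1
    then show ?thesis
      using succ_set_not_linked[OF p x jk(1), of k W] jk W by (auto simp: E_commute)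
  next
    case 2
    then show ?thesis
      using succ_set_not_linked[OF p x jk(2), of j W] jk W by (auto simp: E_commute)
  qed
qed

lemma succ_set_independent:
  assumes p: "longest p" and x: "x \<in> V" "x \<notin> set p"
    and u: "u \<in> insert x (succ_set p x)" "v \<in> insert x (succ_set p x)"
  shows "\<not> E u v"
proof -
  have "\<not> E x (p ! 0)"
    using longest_hd_nbr[OF p, of x] x longest_nonempty[OF p] E_sym by (auto simp: hd_conv_nth)
  moreover have "\<not> E x (p ! Suc i)" if "i \<in> nbr_idx x p" for i
    using nbr_idx_not_consecutive[OF p x that] nbr_idx_Suc_less[OF p x that] by (auto simp: nbr_idx_def)
  ultimately have *: "\<not> E x w" if "w \<in> succ_set p x" for w
    using that by (auto simp: succ_set_def)
  show ?thesis
    using u * succ_set_unlinked[OF p x, of u v "[]"] E_sym by (cases "u = v") auto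
qed

text \<open>Induction along \<open>p\<close>. The vertex after a neighbour of \<open>x\<close> is a
  successor. A vertex of \<open>succ_set p x\<close> that is not the last one is, by
  \<open>sub\<close>, a predecessor of a neighbour, so the next vertex is a neighbour.\<close>

lemma set_subset_succ_set_nbrs:
  assumes p: "longest p" and x: "x \<in> V" "x \<notin> set p"
    and sub: "succ_set p x \<subseteq> succ_set (rev p) x"
  shows "set p \<subseteq> succ_set p x \<union> {v. E x v}"
proof -
  have "p ! j \<in> succ_set p x \<union> {v. E x v}" if "j < length p" for j
    using that
  proof (induction j)
    case 0
    then show ?case by (simp add: succ_set_def)
  next
    case (Suc j)
    show ?case
    proof (cases "E x (p ! j)")
      case True
      then have "j \<in> nbr_idx x p" using Suc by (simp add: nbr_idx_def)
      then show ?thesis by (auto simp: succ_set_def)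
    next
      case False
      then have "p ! j \<in> succ_set (rev p) x" using Suc sub by auto
      then obtain k where k: "k \<in> insert 0 (Suc ` nbr_idx x (rev p))" "p ! j = rev p ! k"
        by (auto simp: succ_set_def)
      have kl: "k < length p"
        using k(1) nbr_idx_Suc_less[of "rev p" x] p x longest_nonempty[OF p] by auto
      then have "p ! j = p ! (length p - Suc k)" using k(2) by (simp add: rev_nth)
      then have "j = length p - Suc k"
        using kl Suc longest_path[OF p] by (auto simp: path_def nth_eq_iff_index_eq)
      with Suc have "k \<noteq> 0" by auto
      then obtain i where "k = Suc i" "i < length p" "E x (rev p ! i)" using k(1) by (auto simp: nbr_idx_def)
      moreover from this have "length p - Suc i = Suc j"
        using \<open>j = _\<close> kl by linarith
      ultimately show ?thesis by (simp add: rev_nth)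
    qed
  qed
  then show ?thesis by (metis in_set_conv_nth subsetI)
qed

text \<open>This is the extra saving for \<open>t = 5\<close>. If \<open>?S\<close> is contained in
  \<open>?T\<close>, then \<open>p\<close> is covered by \<open>?S\<close> and the neighbours of
  \<open>x\<close>, so any \<open>q\<close> in \<open>R\<close> lies off \<open>p\<close> and sees
  at most one vertex of \<open>?S\<close>. Otherwise take \<open>q\<close> in
  \<open>?T - ?S\<close>: independence of \<open>insert x ?T\<close> confines its neighbours to
  \<open>?S - ?T\<close>, which is as large as \<open>?T - ?S\<close>, a subset of
  \<open>R\<close>.\<close>

lemma ex_rest_few_nbrs:
  assumes p: "longest p" and x: "x \<in> V" "x \<notin> set p"
    and R: "R = V - insert x (succ_set p x) - {v. E x v}" "R \<noteq> {}"
  shows "\<exists>q\<in>R. card {u \<in> insert x (succ_set p x). E q u} \<le> card R"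
proof -
  let ?S = "succ_set p x" and ?T = "succ_set (rev p) x"
  have p': "longest (rev p)" "x \<notin> set (rev p)" using p x by auto
  have sub: "?S \<subseteq> set p" "?T \<subseteq> set p"
    using succ_set_subset[OF p x] succ_set_subset[OF p'(1) x(1) p'(2)] by auto
  then have fin: "finite ?S" "finite ?T" by (auto intro: finite_subset)
  have "inj_on (\<lambda>i. length p - Suc i) (nbr_idx x p)" by (auto simp: inj_on_def nbr_idx_def)
  then have card_eq: "card ?S = card ?T"
    using card_succ_set[OF p x] card_succ_set[OF p'(1) x(1) p'(2)] by (simp add: nbr_idx_rev card_image)
  have pV: "set p \<subseteq> V" using longest_path[OF p] by (simp add: path_def)
  have finR: "finite R" using R by simp
  show ?thesis
  proof (cases "?S \<subseteq> ?T")
    case True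
    obtain q where q: "q \<in> R" using R by blast
    then have qp: "q \<notin> set p" "q \<in> V" "q \<noteq> x" "\<not> E q x"
      using set_subset_succ_set_nbrs[OF p x True] R E_sym by auto
    have "u = v" if "u \<in> ?S" "v \<in> ?S" "E q u" "E q v" for u v
      using succ_set_unlinked[OF p x that(1,2), of "[q]" q] qp that by auto
    then have "card {u \<in> insert x ?S. E q u} \<le> 1"
      using qp fin by (subst One_nat_def, subst card_le_Suc0_iff_eq) auto
    also have "1 \<le> card R" using R finR by (simp add: Suc_le_eq card_gt_0_iff)
    finally show ?thesis using q by blast
  next
    case False
    then have "\<not> ?T \<subseteq> ?S" using card_subset_eq[of ?S ?T] fin card_eq by auto
    then obtain q where q: "q \<in> ?T" "q \<notin> ?S" by blast
    have TR: "?T - ?S \<subseteq> R"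
      using R sub pV x succ_set_independent[OF p'(1) x(1) p'(2), of x] by auto
    have "{u \<in> insert x ?S. E q u} \<subseteq> ?S - ?T"
      using succ_set_independent[OF p'(1) x(1) p'(2), of q] q by auto
    then have "card {u \<in> insert x ?S. E q u} \<le> card (?S - ?T)" using fin by (intro card_mono) auto
    also have "\<dots> = card (?T - ?S)"
      using card_eq fin by (simp add: card_Diff_subset_Int Int_commute)
    also have "\<dots> \<le> card R" using TR finR by (rule card_mono[rotated])
    finally show ?thesis using q TR by blast
  qed
qed

section \<open>Edges between an independent set and its complement\<close>

text \<open>Double counting: by independence every edge at \<open>I\<close> leads to
  \<open>V - I\<close>.\<close>

lemma independent_degree_sum:
  assumes "I \<subseteq> V" and indep: "\<And>u v. u \<in> I \<Longrightarrow> v \<in> I \<Longrightarrow> \<not> E u v"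
  shows "(\<Sum>u\<in>I. deg u) = (\<Sum>c\<in>V - I. card {u \<in> I. E c u})"
proof -
  have fin: "finite I" using assms finite_subset finite_V by blast
  have "deg u = (\<Sum>c\<in>V - I. if E u c then 1 else 0)" if "u \<in> I" for u
  proof -
    have "{c. E u c} = {c \<in> V - I. E u c}" using that indep E_V2 by auto
    then show ?thesis by (simp only: degree_eq card_filter_eq_sum[OF finite_Diff[OF finite_V]])
  qed
  then have "(\<Sum>u\<in>I. deg u) = (\<Sum>u\<in>I. \<Sum>c\<in>V - I. if E u c then 1 else 0)" by simp
  also have "\<dots> = (\<Sum>c\<in>V - I. \<Sum>u\<in>I. if E c u then 1 else 0)"
    by (subst sum.swap) (simp only: E_commute)
  also have "\<dots> = (\<Sum>c\<in>V - I. card {u \<in> I. E c u})"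
    by (simp only: card_filter_eq_sum[OF fin])
  finally show ?thesis .
qed

lemma no_induced_star_nbrs:
  assumes "\<not> has_induced_star V E t" "I \<subseteq> V" "c \<in> V - I"
    and indep: "\<And>u v. u \<in> I \<Longrightarrow> v \<in> I \<Longrightarrow> \<not> E u v"
  shows "card {u \<in> I. E c u} < t"
proof (rule ccontr)
  assume "\<not> card {u \<in> I. E c u} < t"
  then obtain L where "L \<subseteq> {u \<in> I. E c u}" "card L = t"
    by (metis not_less obtain_subset_with_card_n)
  then have "has_induced_star V E t"
    unfolding has_induced_star_def using assms by (intro exI[of _ c] exI[of _ L]) blast
  with assms show False by simp
qed

end

section \<open>Consequences of the degree sum condition\<close>

locale ore_nontraceable_graph = nontraceable_graph +
  fixes K :: real
  assumes ore: "\<lbrakk>x \<in> V; y \<in> V; x \<noteq> y; \<not> E x y\<rbrakk> \<Longrightarrow> card V - K \<le> deg x + deg y"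
    and K_bound: "3 * K \<le> card V"
begin

lemma off_longest_nbr:
  assumes p: "longest p" and z: "z \<in> V" "z \<notin> set p" "E z z'"
  shows "z' \<in> set p"
proof (rule ccontr)
  assume z': "z' \<notin> set p"
  let ?P = "\<lambda>Q. path Q \<and> set Q \<inter> set p = {}"
  have "?P [z, z']" using z z' by (auto simp: E_V2)
  moreover have "\<forall>Q. ?P Q \<longrightarrow> length Q < Suc (card V)" using path_length by (auto simp: less_Suc_eq_le)
  ultimately obtain Q where Q: "?P Q" and Qmax: "\<And>Q'. ?P Q' \<Longrightarrow> length Q' \<le> length Q"
    using ex_has_greatest_nat[of ?P "[z, z']" length] by blast
  have l2: "2 \<le> length Q" using Qmax[OF \<open>?P [z, z']\<close>] by simp
  define y where "y = last Q"
  have Qne: "Q \<noteq> []" using l2 by auto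
  have yQ: "y \<in> set Q" using Qne by (simp add: y_def)
  have y: "y \<in> V" "y \<notin> set p" using Q yQ by (auto simp: path_def)
  \<comment> \<open>\<open>Q\<close> cannot be extended, so the neighbours of \<open>y\<close> off
    \<open>p\<close> lie on \<open>Q\<close>. This gives the bound
    \<open>card N + length Q - 1\<close> for \<open>deg y\<close>.\<close>
  have nbr: "w \<in> set Q" if "E y w" "w \<notin> set p" for w
  proof (rule ccontr)
    assume "w \<notin> set Q"
    then have "?P (Q @ [w])" using that Q Qne by (auto simp: y_def E_V2)
    from Qmax[OF this] show False by simp
  qed
  define N where "N = nbr_idx y p"
  have card_Q: "card (set Q) = length Q" using Q by (simp add: path_def distinct_card)
  have "deg y \<le> card ({w \<in> set p. E y w} \<union> (set Q - {y}))"
    unfolding degree_eq by (rule card_mono) (use nbr in auto)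
  also have "\<dots> \<le> card {w \<in> set p. E y w} + card (set Q - {y})" by (rule card_Un_le)
  also have "\<dots> = card N + (length Q - 1)"
    using card_Q yQ by (simp add: N_def card_nbr_idx[OF longest_path[OF p]])
  finally have dy: "deg y + 1 \<le> card N + length Q" using l2 by simp
  have "length Q + length p = card (set Q \<union> set p)"
    using Q longest_path[OF p] by (subst card_Un_disjoint) (auto simp: path_def distinct_card)
  also have "\<dots> \<le> card V" using Q longest_path[OF p] by (intro card_mono) (auto simp: path_def)
  finally have n: "length Q + length p \<le> card V" .
  note ends = longest_hd_last[OF p longest_length_ge_2[OF p]]
  have hl: "card V - K \<le> deg (hd p) + deg (last p)" using ore ends by blast
  have hdl: "hd p \<in> set p" "last p \<in> set p" using longest_nonempty[OF p] by auto
  have yh: "card V - K \<le> deg y + deg (hd p)"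
    using ore[OF y(1) ends(3)] longest_hd_nbr[OF p] E_sym y hdl by blast
  have yl: "card V - K \<le> deg y + deg (last p)"
    using ore[OF y(1) ends(4)] longest_last_nbr[OF p] E_sym y hdl by blast
  show False
  proof (cases "N = {}")
    case True
    then have "deg y + 1 \<le> length Q" using dy by simp
    moreover have "deg (hd p) + deg (last p) + 1 \<le> length p"
      using longest_ends_degree[OF p, of "{}"] by simp
    ultimately show False using yh yl hl n K_bound by linarith
  next
    case False
    \<comment> \<open>The rotation would drop one vertex in exchange for at least two. It is needed
      for both \<open>p\<close> and \<open>rev p\<close>.\<close>
    have rot: "\<not> E (hd r) (r ! (i + 2))"
      if "longest r" "set r = set p" "i \<in> nbr_idx y r" "i + 2 < length r" for r i
      using longest_rotate_idx[of r Q i "i + 2"] that Q l2 by (auto simp: y_def)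
    have 1: "deg (hd p) + deg (last p) + card N \<le> length p"
      unfolding N_def
      by (rule longest_ends_degree_gaps[OF p y])
        (use rot[of p] rot[of "rev p"] p False in \<open>auto simp: N_def hd_rev\<close>)
    have 2: "deg (hd p) + 2 * card N + length Q \<le> length p + 1"
      using longest_hd_degree_off_path[OF p, of Q] Q l2 False by (simp add: N_def y_def)
    \<comment> \<open>With \<open>n = card V\<close>: fact \<open>2\<close> with \<open>yh\<close>
      yields \<open>card N <= K - length Q\<close>, and fact \<open>1\<close> with \<open>yh\<close>
      and \<open>yl\<close> yields \<open>n - 2 * K <= card N + length Q - 2\<close>. Together
      \<open>n <= 3 * K - 2\<close>, against \<open>K_bound\<close>.\<close>
    from 1 2 show False using dy yh yl n K_bound by linarith
  qed
qed

lemma ex_off_longest_large_degree: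
  obtains p x where "longest p" "x \<in> V" "x \<notin> set p" "card V - K \<le> 2 * deg x"
proof -
  let ?P = "\<lambda>x. x \<in> V \<and> (\<exists>p. longest p \<and> x \<notin> set p)"
  obtain x0 where "?P x0" using longest_exists longest_ex_off by metis
  moreover have "\<forall>x. ?P x \<longrightarrow> deg x < Suc (card V)"
    by (auto simp: degree_def less_Suc_eq_le intro: card_mono)
  ultimately obtain x where "?P x" and xmax: "\<And>w. ?P w \<Longrightarrow> deg w \<le> deg x"
    using ex_has_greatest_nat[of ?P x0 deg] by blast
  then obtain p where p: "longest p" and x: "x \<in> V" "x \<notin> set p" by blast
  have "card V - K \<le> 2 * deg x"
  proof (rule ccontr)
    assume small: "\<not> card V - K \<le> 2 * deg x"
    have dx: "deg x = card (nbr_idx x p)"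
      using off_longest_nbr[OF p x] by (intro degree_nbr_idx longest_path p)
    note ends = longest_hd_last[OF p longest_length_ge_2[OF p]]
    have hdl: "hd p \<in> set p" "last p \<in> set p" using longest_nonempty[OF p] by auto
    have xh: "card V - K \<le> deg x + deg (hd p)"
      using ore[OF x(1) ends(3)] longest_hd_nbr[OF p] E_sym x hdl by blast
    have xl: "card V - K \<le> deg x + deg (last p)"
      using ore[OF x(1) ends(4)] longest_last_nbr[OF p] E_sym x hdl by blast
    have n: "length p + 1 \<le> card V" using longest_length_less[OF p] by simp
    show False
    proof (cases "nbr_idx x p = {}")
      case True
      then have "deg x = 0" using dx by simp
      moreover have "deg (hd p) + deg (last p) + 1 \<le> length p"
        using longest_ends_degree[OF p, of "{}"] by simp
      ultimately show False using xh xl n K_bound by linarith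
    next
      case False
      have rot: "\<not> E (hd r) (r ! (i + 2))"
        if r: "longest r" "set r = set p" and i: "i \<in> nbr_idx x r" "i + 2 < length r" for r i
      proof
        assume e: "E (hd r) (r ! (i + 2))"
        have xr: "x \<notin> set r" using r x by simp
        obtain q where q: "longest q" "set q = insert x (set r - {r ! Suc i})"
          using longest_swap_idx[OF r(1) x(1) xr i e] .
        let ?w = "r ! Suc i"
        have w: "?w \<in> V" "?w \<noteq> x" "\<not> E x ?w"
          using i r xr longest_path[OF r(1)] nbr_idx_not_consecutive[OF r(1) x(1) xr i(1)]
          by (auto simp: path_def nbr_idx_def)
        then have "?w \<notin> set q" using q by auto
        then have "deg ?w \<le> deg x" using xmax w q by blast
        moreover have "card V - K \<le> deg x + deg ?w" using ore[OF x(1) w(1)] w by blast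
        ultimately show False using small by linarith
      qed
      have "deg (hd p) + deg (last p) + deg x \<le> length p"
        unfolding dx
        by (rule longest_ends_degree_gaps[OF p x])
          (use rot[of p] rot[of "rev p"] p False in \<open>auto simp: hd_rev\<close>)
      \<comment> \<open>Adding \<open>xh\<close> and \<open>xl\<close> gives
        \<open>deg x >= n - 2 * K + 1\<close> for \<open>n = card V\<close>, and
        \<open>3 * K <= n\<close> turns this into \<open>2 * deg x >= n - K + 2\<close>.\<close>
      then show False using xh xl n K_bound small by linarith
    qed
  qed
  then show thesis using that p x by blast
qed

text \<open>Here the path is forgotten: the final counts only need \<open>x\<close>,
  \<open>I\<close> and the vertices that lie neither in \<open>I\<close> nor next to
  \<open>x\<close>.\<close>

lemma ex_large_independent_set:
  obtains x I where "x \<in> I" "I \<subseteq> V" "card I = deg x + 2" "card V - K \<le> 2 * deg x"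
    "\<forall>u\<in>I. \<forall>v\<in>I. \<not> E u v"
    "V - I - {v. E x v} \<noteq> {} \<longrightarrow> (\<exists>q \<in> V - I - {v. E x v}. card {u \<in> I. E q u} \<le> card (V - I - {v. E x v}))"
proof -
  obtain p x where p: "longest p" and x: "x \<in> V" "x \<notin> set p" and d: "card V - K \<le> 2 * deg x"
    by (rule ex_off_longest_large_degree)
  have S: "succ_set p x \<subseteq> set p" by (rule succ_set_subset[OF p x])
  have pV: "set p \<subseteq> V" using longest_path[OF p] by (simp add: path_def)
  have dx: "deg x = card (nbr_idx x p)"
    using off_longest_nbr[OF p x] by (intro degree_nbr_idx longest_path p)
  show thesis
  proof (rule that[of x "insert x (succ_set p x)"])
    have "finite (succ_set p x)" using S finite_subset by blast
    then show "card (insert x (succ_set p x)) = deg x + 2"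
      using card_succ_set[OF p x] dx S x by (subst card_insert_disjoint) auto
    show "insert x (succ_set p x) \<subseteq> V" using S pV x by auto
  qed (use d succ_set_independent[OF p x] ex_rest_few_nbrs[OF p x refl] in auto)
qed

end

section \<open>Numerical estimates for the star count\<close>

text \<open>At most one value lies below \<open>a / 2\<close>; it is summed together with one other
  value, and the remaining ones are bounded separately.\<close>

lemma sum_ge_half_pairwise:
  fixes f :: "'b \<Rightarrow> real"
  assumes fin: "finite I" and two: "2 \<le> card I"
    and pair: "\<And>u v. u \<in> I \<Longrightarrow> v \<in> I \<Longrightarrow> u \<noteq> v \<Longrightarrow> a \<le> f u + f v"
  shows "card I * (a / 2) \<le> sum f I"
proof (cases "\<exists>u\<in>I. f u < a / 2")
  case False
  then show ?thesis using sum_bounded_below[of I "a / 2" f] by (auto simp: not_less)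
next
  case True
  then obtain u where u: "u \<in> I" "f u < a / 2" by blast
  have "\<not> I \<subseteq> {u}" using card_mono[of "{u}" I] two by auto
  then obtain v where v: "v \<in> I" "v \<noteq> u" by blast
  have "card (I - {u, v}) * (a / 2) \<le> sum f (I - {u, v})"
  proof (rule sum_bounded_below)
    fix w assume "w \<in> I - {u, v}"
    then show "a / 2 \<le> f w" using pair[of u w] u by auto
  qed
  moreover have "card (I - {u, v}) = card I - 2" using u v fin by (subst card_Diff_subset) auto
  moreover have "sum f I = f u + f v + sum f (I - {u, v})"
    using u v fin by (subst sum.subset_diff[of "{u, v}" I]) auto
  moreover have "a \<le> f u + f v" using pair u v by auto
  ultimately show ?thesis using two by (simp add: of_nat_diff algebra_simps)
qed

text \<open>The inequality \<open>le\<close> persists when \<open>d\<close> is lowered to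
  \<open>h\<close>, half of \<open>n - K\<close>, which leaves a condition on \<open>K\<close> and
  \<open>t\<close> alone. Integrality of \<open>n\<close> sharpens \<open>2 < K\<close> to
  \<open>2 + 1 / (t - 2) <= K\<close>; this is what settles \<open>t = 6\<close>, where
  \<open>9 * K <= 20\<close> must fail.\<close>

lemma star_count_ge_6:
  fixes K :: real and t n d :: nat
  assumes t: "6 \<le> t" and n: "2 * t - 4 < n" "real n = K * (real t - 2)" and d: "real n - K \<le> 2 * real d"
    and le: "(real d + 2) * ((real n - K) / 2) \<le> (real t - 1) * (real n - real d - 2)"
  shows False
proof -
  define h where "h = K * (real t - 3) / 2"
  have h: "(real n - K) / 2 = h" unfolding h_def n(2) by (simp add: field_simps)
  have "2 * t + 1 \<le> n + 4" using n(1) t by linarith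
  then have "real (2 * t + 1) \<le> real (n + 4)" by (rule of_nat_mono)
  then have "2 * (real t - 2) + 1 \<le> real n" by simp
  then have nK: "2 * (real t - 2) + 1 \<le> K * (real t - 2)" unfolding n(2) .
  have pos: "0 < real t - 2" using t by simp
  have "2 + 1 / r = (2 * r + 1) / r" if "0 < r" for r :: real using that by (simp add: field_simps)
  from this[OF pos] have "2 + 1 / (real t - 2) = (2 * (real t - 2) + 1) / (real t - 2)" .
  also have "\<dots> \<le> K" using nK pos by (simp only: pos_divide_le_eq)
  finally have K: "2 + 1 / (real t - 2) \<le> K" .
  moreover have "0 < 1 / (real t - 2)" using pos by simp
  ultimately have K2: "2 < K" by linarith
  then have h0: "0 \<le> h" using t by (simp add: h_def)
  have hd: "h \<le> real d" using d unfolding h[symmetric] by simp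
  have "(h + 2) * h \<le> (real d + 2) * h" using hd h0 by (intro mult_right_mono) auto
  also have "\<dots> \<le> (real t - 1) * (real n - real d - 2)" using le h by simp
  also have "\<dots> \<le> (real t - 1) * (real n - h - 2)" using hd t by (intro mult_left_mono) auto
  finally have "(h + 2) * h \<le> (real t - 1) * (real n - h - 2)" .
  \<comment> \<open>Substituting \<open>n\<close> and \<open>h\<close> makes the difference of the
    two sides a multiple of \<open>K - 2\<close>, reflecting equality at
    \<open>n = 2 * t - 4\<close>.\<close>
  then have "(K - 2) * ((real t - 3)\<^sup>2 * K - 4 * (real t - 1)) \<le> 0"
    unfolding n(2) h_def by (simp add: field_simps power2_eq_square)
  then have *: "(real t - 3)\<^sup>2 * K \<le> 4 * (real t - 1)"
    using K2 by (simp add: mult_le_0_iff)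
  show False
  proof (cases "t = 6")
    case True
    then show False using * K by simp
  next
    case False
    then have "7 \<le> real t" using t by simp
    then have "0 \<le> (real t - 7) * (real t - 1)" by simp
    then have "4 * (real t - 1) < (real t - 3)\<^sup>2 * 2"
      by (simp add: power2_eq_square algebra_simps)
    also have "\<dots> \<le> (real t - 3)\<^sup>2 * K" using K2 by (intro mult_left_mono) auto
    finally show False using * by simp
  qed
qed

text \<open>The last assumption fails once \<open>d + 2 >= 12\<close>, so only finitely many
  \<open>d\<close> remain, and they are checked one by one.\<close>

lemma star_count_5:
  fixes n d :: nat
  assumes "6 < n" "n \<le> 3 * d" "2 * d + 2 \<le> n" "(d + 2) * n + 12 * (d + 2) \<le> 12 * n"
  shows "n = 3 * d" "d = 3 \<or> d = 4"
proof -
  have "d < 10"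
  proof (rule ccontr)
    assume "\<not> d < 10"
    then have "12 * n \<le> (d + 2) * n" by (intro mult_right_mono) auto
    moreover have "(d + 2) * n < 12 * n" using assms(4) by (rule less_le_trans[rotated]) simp
    ultimately show False by simp
  qed
  then have "d = 0 \<or> d = 1 \<or> d = 2 \<or> d = 3 \<or> d = 4 \<or> d = 5 \<or> d = 6 \<or> d = 7 \<or> d = 8 \<or> d = 9" by auto
  then show "n = 3 * d" "d = 3 \<or> d = 4" using assms by (elim disjE; simp)+
qed

section \<open>The bound on the order, the induced star and the join structure\<close>

theorem theorem3:
  fixes V :: "'a set" and E :: "'a \<Rightarrow> 'a \<Rightarrow> bool" and t n :: nat
  assumes "t \<ge> 5"
    and "simple_graph V E"
    and "connected_graph V E"
    and "n = card V"
    and "sigma2 V E \<ge> ereal ((real t - 3) / (real t - 2) * real n)"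
    and "\<not> (\<exists>p. hamiltonian_path V E p)"
  shows "n \<ge> 2 * t - 4
         \<and> (n > 2 * t - 4 \<longrightarrow> has_induced_star V E t)
         \<and> (n = 2 * t - 4 \<longrightarrow> is_join_with_empty V E (t - 3) (t - 1))"
proof -
  define K where "K = real n / (real t - 2)"
  have nK: "real n = K * (real t - 2)" using assms(1) by (simp add: K_def)
  have "(real t - 3) / (real t - 2) * real n = real n - K"
    using assms(1) by (simp add: K_def field_simps)
  with assms(5) have sigma: "ereal (real n - K) \<le> sigma2 V E" by simp
  have nonneg: "0 \<le> K" using assms(1) by (simp add: K_def)
  interpret ore_nontraceable_graph V E K
  proof
    fix x y assume "x \<in> V" "y \<in> V" "x \<noteq> y" "\<not> E x y"
    then have "sigma2 V E \<le> ereal (real (degree V E (fst (x, y)) + degree V E (snd (x, y))))"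
      unfolding sigma2_def by (intro INF_lower) auto
    with sigma have "ereal (real n - K) \<le> ereal (real (degree V E x + degree V E y))"
      using order_trans by fastforce
    then show "real (card V) - K \<le> real (degree V E x + degree V E y)"
      using assms(4) by simp
  next
    show "3 * K \<le> real (card V)"
      using assms(1,4) nK nonneg mult_left_mono[of 3 "real t - 2" K] by simp
  qed (use assms in auto)
  obtain x I where xI: "x \<in> I" "I \<subseteq> V" and card_I: "card I = deg x + 2" and d: "card V - K \<le> 2 * deg x"
    and "\<forall>u\<in>I. \<forall>v\<in>I. \<not> E u v"
    and few: "V - I - {v. E x v} \<noteq> {} \<longrightarrow>
      (\<exists>q \<in> V - I - {v. E x v}. card {u \<in> I. E q u} \<le> card (V - I - {v. E x v}))"
    by (rule ex_large_independent_set)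
  then have indep: "\<not> E u v" if "u \<in> I" "v \<in> I" for u v using that by blast
  define N where "N = {v. E x v}"
  \<comment> \<open>\<open>V\<close> splits into \<open>I\<close> with \<open>deg x + 2\<close>
    elements, \<open>N\<close> with \<open>deg x\<close> elements, and the rest
    \<open>R\<close>.\<close>
  define R where "R = V - I - N"
  have NV: "N \<subseteq> V" and IN: "I \<inter> N = {}" using indep xI by (auto simp: N_def E_V2)
  have fin: "finite I" "finite N" "finite R"
    using xI NV finite_V by (auto simp: R_def intro: finite_subset)
  have card_N: "card N = deg x" by (simp add: N_def degree_eq)
  have VI: "V - I = N \<union> R" using NV IN by (auto simp: R_def)
  have NR: "N \<inter> R = {}" by (auto simp: R_def)
  have "card (V - I) = card V - card I" using xI fin by (simp add: card_Diff_subset)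
  moreover have "card I \<le> card V" using xI by (simp add: card_mono)
  moreover have card_VI: "card (V - I) = deg x + card R"
    unfolding VI using fin NR card_N by (simp add: card_Un_disjoint)
  ultimately have n: "n = 2 * deg x + 2 + card R" using card_I assms(4) by linarith
  have d': "real n - K \<le> 2 * real (deg x)" using d assms(4) by simp
  \<comment> \<open>Since \<open>n - K <= 2 * deg x <= n - 2\<close>.\<close>
  have "2 \<le> K" using d' n by simp
  then have "2 * (real t - 2) \<le> real n" using nK assms(1) mult_right_mono[of 2 K "real t - 2"] by simp
  then have "real (2 * t) \<le> real (n + 4)" by simp
  then have "2 * t \<le> n + 4" by (simp only: of_nat_le_iff)
  then have part0: "2 * t - 4 \<le> n" by simp
  have deg_ge: "real n - K \<le> deg x + deg u" if "u \<in> I" for u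
    using ore[of x u] d' that xI indep assms(4) by (cases "u = x") auto
  have nbr: "{v. E u v} \<subseteq> N \<union> R" if "u \<in> I" for u
    using that indep VI E_V2 by blast

  \<comment> \<open>Without the star, each of the \<open>n - deg x - 2\<close> vertices outside
    \<open>I\<close> has at most \<open>t - 1\<close> neighbours in \<open>I\<close>, while the
    degrees in \<open>I\<close> average at least half of \<open>n - K\<close>.\<close>
  have part1: "has_induced_star V E t" if big: "2 * t - 4 < n"
  proof (rule ccontr)
    assume no: "\<not> has_induced_star V E t"
    have le: "card {u \<in> I. E c u} \<le> t - 1" if "c \<in> V - I" for c
      using no_induced_star_nbrs[OF no xI(2) that indep] by simp
    have sum_eq: "(\<Sum>u\<in>I. deg u) = (\<Sum>c\<in>V - I. card {u \<in> I. E c u})"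
      using independent_degree_sum[OF xI(2) indep] .
    also have "\<dots> \<le> card (V - I) * (t - 1)" using sum_bounded_above[of "V - I" _ "t - 1"] le by simp
    finally have "(\<Sum>u\<in>I. deg u) \<le> card (V - I) * (t - 1)" .
    then have upper: "(\<Sum>u\<in>I. real (deg u)) \<le> (real t - 1) * (real n - real (deg x) - 2)"
    proof -
      have "real (card (V - I)) = real n - real (deg x) - 2" using card_VI n by simp
      moreover have "real (t - 1) = real t - 1" using assms(1) by simp
      ultimately show ?thesis
        using \<open>(\<Sum>u\<in>I. deg u) \<le> _\<close> by (metis mult.commute of_nat_le_iff of_nat_mult of_nat_sum)
    qed
    have "card I * ((real n - K) / 2) \<le> (\<Sum>u\<in>I. real (deg u))"
    proof (rule sum_ge_half_pairwise)
      fix u v assume "u \<in> I" "v \<in> I" "u \<noteq> v"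
      then show "real n - K \<le> real (deg u) + real (deg v)"
        using ore[of u v] indep[of u v] xI(2) assms(4) by auto
    qed (use fin card_I in auto)
    with upper have cnt: "(real (deg x) + 2) * ((real n - K) / 2) \<le> (real t - 1) * (real n - real (deg x) - 2)"
      using card_I by (simp add: add.commute)
    show False
    proof (cases "t = 5")
      case False
      then show False using star_count_ge_6[OF _ big nK d' cnt] assms(1) by simp
    next
      case True
      define k where "k = deg x"
      have Kn: "3 * K = real n" using nK True by simp
      have "real n \<le> 3 * real k" using d' Kn by (simp add: k_def)
      then have 1: "n \<le> 3 * k" by linarith
      have "(real k + 2) * real n + 12 * (real k + 2) \<le> 12 * real n"
      proof -
        have "(real n - K) / 2 = real n / 3" using Kn by simp
        then show ?thesis using cnt True by (simp add: k_def field_simps)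
      qed
      then have "(k + 2) * n + 12 * (k + 2) \<le> 12 * n"
        by (metis (mono_tags) of_nat_add of_nat_le_iff of_nat_mult of_nat_numeral)
      then have nk: "n = 3 * k" "k = 3 \<or> k = 4"
        using star_count_5[of n k] 1 big n True by (auto simp: k_def)
      then have card_R: "card R = k - 2" using n by (simp add: k_def)
      \<comment> \<open>From here every vertex of \<open>I\<close> has degree at least
        \<open>n - K - k = k\<close>, and \<open>R\<close> has \<open>k - 2\<close>
        elements.\<close>
      have "K = k" using Kn nk by simp
      then have "k \<le> deg u" if "u \<in> I" for u using deg_ge[OF that] nk by (simp add: k_def)
      then have "card I * k \<le> (\<Sum>u\<in>I. deg u)" using sum_bounded_below[of I k deg] by simp
      also have "\<dots> = (\<Sum>c\<in>N. card {u \<in> I. E c u}) + (\<Sum>c\<in>R. card {u \<in> I. E c u})"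
        unfolding sum_eq VI using fin NR by (intro sum.union_disjoint)
      also have "(\<Sum>c\<in>N. card {u \<in> I. E c u}) \<le> k * 4"
        using sum_bounded_above[of N "\<lambda>c. card {u \<in> I. E c u}" 4] le True card_N VI by (simp add: k_def)
      finally have low: "(k + 2) * k \<le> k * 4 + (\<Sum>c\<in>R. card {u \<in> I. E c u})"
        using card_I by (simp add: k_def)
      have "R \<noteq> {}" using card_R nk by auto
      then obtain q where q: "q \<in> R" "card {u \<in> I. E q u} \<le> k - 2"
        using few card_R unfolding R_def N_def by auto
      have "(\<Sum>c\<in>R. card {u \<in> I. E c u}) = card {u \<in> I. E q u} + (\<Sum>c\<in>R - {q}. card {u \<in> I. E c u})"
        using fin q by (simp add: sum.remove)
      also have "(\<Sum>c\<in>R - {q}. card {u \<in> I. E c u}) \<le> card (R - {q}) * 4"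
        using sum_bounded_above[of "R - {q}" "\<lambda>c. card {u \<in> I. E c u}" 4] le True VI by simp
      also have "card (R - {q}) = k - 3" using q card_R fin by simp
      \<comment> \<open>Bounding every vertex of \<open>R\<close> by 4 would give only
        \<open>15 <= 16\<close> or \<open>24 <= 24\<close>. The vertex \<open>q\<close> lowers the
        right-hand sides to 13 and 22.\<close>
      finally have "(k + 2) * k \<le> k * 4 + (k - 2) + (k - 3) * 4" using low q by linarith
      then show False using nk(2) by auto
    qed
  qed

  \<comment> \<open>Now \<open>K = 2\<close> forces \<open>R\<close> to be empty. Each vertex of
    \<open>I\<close> then has degree at least \<open>card N\<close> and all its neighbours in
    \<open>N\<close>, so it is joined to all of \<open>N\<close>; the sizes are
    \<open>deg x = t - 3\<close> and \<open>deg x + 2 = t - 1\<close>.\<close>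
  have part2: "is_join_with_empty V E (t - 3) (t - 1)" if eq: "n = 2 * t - 4"
  proof -
    have "real n = 2 * (real t - 2)" using eq assms(1) by simp
    then have "K * (real t - 2) = 2 * (real t - 2)" using nK by simp
    then have K: "K = 2" using assms(1) by (subst (asm) mult_cancel_right) auto
    then have "n \<le> 2 * deg x + 2" using d' by linarith
    then have R: "R = {}" and n': "n = 2 * deg x + 2" using n fin by auto
    have "E a b" if a: "a \<in> N" and b: "b \<in> I" for a b
    proof -
      have "deg x \<le> deg b" using deg_ge[OF b] K n' by linarith
      then have "{v. E b v} = N"
        using nbr[OF b] R card_N fin by (intro card_seteq) (auto simp: degree_eq)
      then show ?thesis using a E_sym by blast
    qed
    then show ?thesis
      unfolding is_join_with_empty_def using VI R IN xI indep card_N card_I n' eq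
      by (intro exI[of _ N] exI[of _ I]) auto
  qed
  show ?thesis using part0 part1 part2 by blast
qed

end
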